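(* Let $\rho:B_n\to GL_r(\mathbb{C})$ be an irreducible representation with $r\ge n$, and suppose that $\rho(\sigma_i)=1+A_i$ with $\operatorname{rank}(A_i)=2$ for every generator $\sigma_i$. Then: 1) If $n\ge 6$, then $r=n$ and the friendship graph of $\rho$ is a chain. 2) If $n=5$, then $r=5$ and either the friendship graph of $\rho$ is a chain, or it is the exceptional graph on $A_1,A_2,A_3,A_4$ whose edges are exactly $A_1A_3$, $A_1A_4$, $A_2A_4$. 3) If $n=4$, then either $r=4$ and the friendship graph of $\rho$ is a chain, or the friendship graph of $\rho$ is one of the following two exceptional graphs on $A_1,A_2,A_3$: the graph whose only edge is $A_1A_3$, or the complete graph with edges $A_1A_2$, $A_2A_3$, $A_1A_3$.
   Context: $B_n$ is the Artin braid group on $n$ strings, $B_n=\langle \sigma_1,\dots,\sigma_{n-1}\mid \sigma_i\sigma_{i+1}\sigma_i=\sigma_{i+1}\sigma_i\sigma_{i+1}\ (1\le i\le n-2),\ \sigma_i\sigma_j=\sigma_j\sigma_i\ (|i-j|\ge 2)\rangle$. For a representation $\rho$ of $B_n$ with $\rho(\sigma_i)=1+A_i$, the friendship graph of $\rho$ is the simple graph with vertices $A_1,\dots,A_{n-1}$ (one vertex for each index) in which $A_i$ and $A_j$ ($i\ne j$) are joined by an edge if and only if $\operatorname{Im}(A_i)\cap\operatorname{Im}(A_j)\ne\{0\}$. The friendship graph is a chain if $A_i$ and $A_j$ are joined by an edge exactly when $|i-j|=1$. *)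

theory Defs
  imports "HOL-Analysis.Analysis" "HOL-Algebra.Group"
begin

text \<open>A letter \<open>(x, True)\<close> stands for the generator \<open>x\<close>, and \<open>(x, False)\<close> for its formal inverse.\<close>

type_synonym 'a gword = "('a \<times> bool) list"

definition gwords :: "'a set \<Rightarrow> 'a gword set" where
  "gwords S = lists (S \<times> UNIV)"

inductive_set word_rel :: "'a set \<Rightarrow> ('a gword \<times> 'a gword) set \<Rightarrow> ('a gword \<times> 'a gword) set"
  for S R where
  refl: "w \<in> gwords S \<Longrightarrow> (w, w) \<in> word_rel S R"
| sym: "(u, v) \<in> word_rel S R \<Longrightarrow> (v, u) \<in> word_rel S R"
| trans: "(u, v) \<in> word_rel S R \<Longrightarrow> (v, w) \<in> word_rel S R \<Longrightarrow> (u, w) \<in> word_rel S R"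
| cancel: "u \<in> gwords S \<Longrightarrow> v \<in> gwords S \<Longrightarrow> x \<in> S \<Longrightarrow>
    (u @ [(x, b), (x, \<not> b)] @ v, u @ v) \<in> word_rel S R"
| relator: "u \<in> gwords S \<Longrightarrow> v \<in> gwords S \<Longrightarrow> (l, r) \<in> R \<Longrightarrow> l \<in> gwords S \<Longrightarrow> r \<in> gwords S \<Longrightarrow>
    (u @ l @ v, u @ r @ v) \<in> word_rel S R"

definition presented_group :: "'a set \<Rightarrow> ('a gword \<times> 'a gword) set \<Rightarrow> 'a gword set monoid" where
  "presented_group S R =
    \<lparr>carrier = gwords S // word_rel S R,
     mult = (\<lambda>X Y. \<Union>x\<in>X. \<Union>y\<in>Y. word_rel S R `` {x @ y}),
     one = word_rel S R `` {[]}\<rparr>"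

lemma gwords_simps [simp]:
  "[] \<in> gwords S"
  "(a # w) \<in> gwords S \<longleftrightarrow> fst a \<in> S \<and> w \<in> gwords S"
  "(u @ v) \<in> gwords S \<longleftrightarrow> u \<in> gwords S \<and> v \<in> gwords S"
  by (auto simp: gwords_def mem_Times_iff)

lemma word_rel_gwords:
  "(u, v) \<in> word_rel S R \<Longrightarrow> u \<in> gwords S \<and> v \<in> gwords S"
  by (induction rule: word_rel.induct) auto

lemma equiv_word_rel: "equiv (gwords S) (word_rel S R)"
proof (rule equivI)
  show "word_rel S R \<subseteq> gwords S \<times> gwords S"
    using word_rel_gwords by fastforce
  show "refl_on (gwords S) (word_rel S R)"
    by (intro refl_onI word_rel.refl)
  show "Relation.sym (word_rel S R)" by (rule symI) (rule word_rel.sym)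
  show "Relation.trans (word_rel S R)" by (rule transI) (rule word_rel.trans)
qed

lemma word_rel_append_context:
  "(u, v) \<in> word_rel S R \<Longrightarrow> p \<in> gwords S \<Longrightarrow> q \<in> gwords S \<Longrightarrow>
    (p @ u @ q, p @ v @ q) \<in> word_rel S R"
proof (induction rule: word_rel.induct)
  case (refl w)
  then show ?case by (intro word_rel.refl) simp
next
  case (sym u v)
  from word_rel.sym[OF sym.IH[OF sym.prems]] show ?case .
next
  case (trans u v w)
  from word_rel.trans[OF trans.IH(1)[OF trans.prems] trans.IH(2)[OF trans.prems]] show ?case .
next
  case (cancel u v x b)
  then show ?case using word_rel.cancel[of "p @ u" S "v @ q" x b R] by simp
next
  case (relator u v l r)
  then show ?case using word_rel.relator[of "p @ u" S "v @ q" l r R] by simp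
qed

lemma word_rel_append:
  assumes "(u, v) \<in> word_rel S R" "(u', v') \<in> word_rel S R"
  shows "(u @ u', v @ v') \<in> word_rel S R"
proof -
  have "(u @ u', v @ u') \<in> word_rel S R"
    using word_rel_append_context[OF assms(1), of "[]" u'] word_rel_gwords[OF assms(2)] by simp
  moreover have "(v @ u', v @ v') \<in> word_rel S R"
    using word_rel_append_context[OF assms(2), of v "[]"] word_rel_gwords[OF assms(1)] by simp
  ultimately show ?thesis by (rule word_rel.trans)
qed

lemma presented_group_mult:
  assumes "u \<in> gwords S" "v \<in> gwords S"
  shows "word_rel S R `` {u} \<otimes>\<^bsub>presented_group S R\<^esub> word_rel S R `` {v} = word_rel S R `` {u @ v}"
proof -
  have "congruent2 (word_rel S R) (word_rel S R) (\<lambda>x y. word_rel S R `` {x @ y})"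
    using word_rel_append equiv_class_eq[OF equiv_word_rel]
    by (intro congruent2I') blast
  then show ?thesis
    using UN_equiv_class2[OF equiv_word_rel equiv_word_rel _ assms] 
    by (simp add: presented_group_def)
qed

lemma word_rel_inverse:
  "w \<in> gwords S \<Longrightarrow> (rev (map (\<lambda>(x, b). (x, \<not> b)) w) @ w, []) \<in> word_rel S R"
proof (induction w)
  case Nil
  then show ?case by (simp add: word_rel.refl)
next
  case (Cons a w)
  obtain x b where a: "a = (x, b)" by force
  let ?i = "rev (map (\<lambda>(x, b). (x, \<not> b)) w)"
  have i: "?i \<in> gwords S" using Cons.prems by (auto simp: gwords_def)
  have "(?i @ [(x, \<not> b), (x, \<not> \<not> b)] @ w, ?i @ w) \<in> word_rel S R"
    using Cons.prems a i by (intro word_rel.cancel) auto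
  moreover have "(?i @ w, []) \<in> word_rel S R" using Cons by simp
  ultimately have "(?i @ [(x, \<not> b), (x, \<not> \<not> b)] @ w, []) \<in> word_rel S R"
    by (rule word_rel.trans)
  then show ?case using a by simp
qed

theorem group_presented_group: "group (presented_group S R)"
proof (rule groupI)
  let ?G = "presented_group S R" and ?E = "word_rel S R"
  have car: "carrier ?G = gwords S // ?E" and one: "\<one>\<^bsub>?G\<^esub> = ?E `` {[]}"
    by (simp_all add: presented_group_def)
  show "\<one>\<^bsub>?G\<^esub> \<in> carrier ?G" by (simp add: car one quotientI)
  fix X assume "X \<in> carrier ?G"
  then obtain x where x: "x \<in> gwords S" "X = ?E `` {x}" by (auto simp: car elim: quotientE)
  show "\<one>\<^bsub>?G\<^esub> \<otimes>\<^bsub>?G\<^esub> X = X" using x by (simp add: one presented_group_mult)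
  let ?i = "rev (map (\<lambda>(x, b). (x, \<not> b)) x)"
  have i: "?i \<in> gwords S" using x by (auto simp: gwords_def)
  have "?E `` {?i} \<otimes>\<^bsub>?G\<^esub> X = \<one>\<^bsub>?G\<^esub>"
    using word_rel_inverse[OF x(1)] x i
    by (simp add: one presented_group_mult equiv_class_eq[OF equiv_word_rel])
  then show "\<exists>Y\<in>carrier ?G. Y \<otimes>\<^bsub>?G\<^esub> X = \<one>\<^bsub>?G\<^esub>" using i by (auto simp: car quotientI)
  fix Y assume "Y \<in> carrier ?G"
  then obtain y where y: "y \<in> gwords S" "Y = ?E `` {y}" by (auto simp: car elim: quotientE)
  show "X \<otimes>\<^bsub>?G\<^esub> Y \<in> carrier ?G" using x y by (simp add: car presented_group_mult quotientI)
  fix Z assume "Z \<in> carrier ?G"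
  then obtain z where z: "z \<in> gwords S" "Z = ?E `` {z}" by (auto simp: car elim: quotientE)
  show "X \<otimes>\<^bsub>?G\<^esub> Y \<otimes>\<^bsub>?G\<^esub> Z = X \<otimes>\<^bsub>?G\<^esub> (Y \<otimes>\<^bsub>?G\<^esub> Z)"
    using x y z by (simp add: presented_group_mult)
qed

definition braid_relations :: "nat \<Rightarrow> (nat gword \<times> nat gword) set" where
  "braid_relations n =
    {([(i, True), (i + 1, True), (i, True)], [(i + 1, True), (i, True), (i + 1, True)]) | i.
      1 \<le> i \<and> i + 2 \<le> n} \<union>
    {([(i, True), (j, True)], [(j, True), (i, True)]) | i j.
      i \<in> {1..<n} \<and> j \<in> {1..<n} \<and> (i + 2 \<le> j \<or> j + 2 \<le> i)}"

definition braid_group :: "nat \<Rightarrow> nat gword set monoid" where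
  "braid_group n = presented_group {1..<n} (braid_relations n)"

definition braid_gen :: "nat \<Rightarrow> nat \<Rightarrow> nat gword set" where
  "braid_gen n i = word_rel {1..<n} (braid_relations n) `` {[(i, True)]}"

lemma group_braid_group: "group (braid_group n)"
  by (simp add: braid_group_def group_presented_group)

lemma braid_gen_carrier: "i \<in> {1..<n} \<Longrightarrow> braid_gen n i \<in> carrier (braid_group n)"
  by (simp add: braid_gen_def braid_group_def presented_group_def quotientI)

lemma braid_gen_braid:
  assumes "1 \<le> i" "i + 2 \<le> n"
  shows "braid_gen n i \<otimes>\<^bsub>braid_group n\<^esub> braid_gen n (i + 1) \<otimes>\<^bsub>braid_group n\<^esub> braid_gen n i =
    braid_gen n (i + 1) \<otimes>\<^bsub>braid_group n\<^esub> braid_gen n i \<otimes>\<^bsub>braid_group n\<^esub> braid_gen n (i + 1)"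
proof -
  have "([(i, True), (i + 1, True), (i, True)], [(i + 1, True), (i, True), (i + 1, True)])
      \<in> word_rel {1..<n} (braid_relations n)"
    using assms word_rel.relator[of "[]" "{1..<n}" "[]" "[(i, True), (i + 1, True), (i, True)]"
      "[(i + 1, True), (i, True), (i + 1, True)]" "braid_relations n"]
    by (auto simp: braid_relations_def)
  then show ?thesis using assms equiv_class_eq[OF equiv_word_rel]
    by (simp add: braid_gen_def braid_group_def presented_group_mult)
qed

lemma braid_gen_commute:
  assumes "i \<in> {1..<n}" "j \<in> {1..<n}" "i + 2 \<le> j \<or> j + 2 \<le> i"
  shows "braid_gen n i \<otimes>\<^bsub>braid_group n\<^esub> braid_gen n j =
    braid_gen n j \<otimes>\<^bsub>braid_group n\<^esub> braid_gen n i"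
proof -
  have "([(i, True), (j, True)], [(j, True), (i, True)])
      \<in> word_rel {1..<n} (braid_relations n)"
    using assms word_rel.relator[of "[]" "{1..<n}" "[]" "[(i, True), (j, True)]"
      "[(j, True), (i, True)]" "braid_relations n"]
    by (auto simp: braid_relations_def)
  then show ?thesis using assms equiv_class_eq[OF equiv_word_rel]
    by (simp add: braid_gen_def braid_group_def presented_group_mult)
qed

definition GL :: "(complex^'r^'r) monoid" where
  "GL = \<lparr>carrier = {M. invertible M}, mult = (**), one = mat 1\<rparr>"

lemma group_GL: "group GL"
proof (rule groupI)
  fix M :: "complex^'r^'r" assume "M \<in> carrier GL"
  then obtain N where "M ** N = mat 1" "N ** M = mat 1"
    by (auto simp: GL_def invertible_def)
  then show "\<exists>N\<in>carrier GL. N \<otimes>\<^bsub>GL\<^esub> M = \<one>\<^bsub>GL\<^esub>"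
    by (auto simp: GL_def invertible_def)
qed (auto simp: GL_def invertible_mult matrix_mul_assoc invertible_def[of "mat 1"] intro: exI[of _ "mat 1"])

text \<open>No nontriviality clause is needed: \<open>complex^'r\<close> is nonzero because index types are nonempty.\<close>

definition irreducible_rep :: "('g, 'm) monoid_scheme \<Rightarrow> ('g \<Rightarrow> complex^'r^'r) \<Rightarrow> bool" where
  "irreducible_rep G \<rho> \<longleftrightarrow> \<rho> \<in> hom G GL \<and>
    (\<forall>W. vec.subspace W \<longrightarrow> (\<forall>g\<in>carrier G. \<forall>w\<in>W. \<rho> g *v w \<in> W) \<longrightarrow> W = {0} \<or> W = UNIV)"

text \<open>The matrix \<open>A\<^sub>i\<close> with \<open>\<rho>(\<sigma>\<^sub>i) = 1 + A\<^sub>i\<close>.\<close>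

definition gen_part :: "nat \<Rightarrow> (nat gword set \<Rightarrow> complex^'r^'r) \<Rightarrow> nat \<Rightarrow> complex^'r^'r" where
  "gen_part n \<rho> i = \<rho> (braid_gen n i) - mat 1"

definition image_space :: "complex^'r^'r \<Rightarrow> (complex^'r) set" where
  "image_space M = range (\<lambda>v. M *v v)"

text \<open>A simple graph is a pair of a vertex set and a set of two-element sets of vertices; the
  vertex \<open>A\<^sub>i\<close> is represented by its index \<open>i\<close>, since the \<open>A\<^sub>i\<close> need not be distinct as matrices.\<close>

definition friendship_graph ::
  "nat \<Rightarrow> (nat gword set \<Rightarrow> complex^'r^'r) \<Rightarrow> nat set \<times> nat set set" where
  "friendship_graph n \<rho> =
    ({1..<n},
     {{i, j} | i j. i \<in> {1..<n} \<and> j \<in> {1..<n} \<and> i \<noteq> j \<and>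
       image_space (gen_part n \<rho> i) \<inter> image_space (gen_part n \<rho> j) \<noteq> {0}})"

definition chain_graph :: "nat \<Rightarrow> nat set \<times> nat set set" where
  "chain_graph n = ({1..<n}, {{i, i + 1} | i. i \<in> {1..<n} \<and> i + 1 \<in> {1..<n}})"

end

theory Submission
  imports Defs
begin

text \<open>
  Write \<open>A\<^sub>i\<close> for the \<open>i\<close>-th generator minus the identity and \<open>I\<^sub>i\<close> for its image, a plane. The sum
  of all \<open>I\<^sub>i\<close> is invariant, so irreducibility makes it the whole space, of dimension \<open>r \<ge> n\<close>.

  Any two pairs of adjacent generators are simultaneously conjugate in the braid group, and so are any
  two pairs of distant ones (\<open>friends_adjacent\<close>, \<open>friends_distant\<close>). Hence whether \<open>I\<^sub>i\<close> meets \<open>I\<^sub>j\<close>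
  depends only on whether \<open>\<bar>i - j\<bar> = 1\<close>, which leaves four graphs: the empty graph, the chain, the
  complement of the chain and the complete graph.

  A plane that meets one of the planes already collected adds at most one dimension to their sum.
  A connected friendship graph on \<open>n - 1\<close> vertices therefore gives \<open>r \<le> n\<close>, hence \<open>r = n\<close>, and leaves
  no slack: a group of \<open>k\<close> planes that spans fewer than \<open>k + 1\<close> dimensions and to which all other
  planes attach would give \<open>r < n\<close> (\<open>dimension_bound\<close>). For \<open>n \<ge> 6\<close> the complement of the chain
  contains such a group, the planes with indices 1, 2, 4, 5 (\<open>not_chain_complement\<close>). In a complete
  graph with \<open>n \<ge> 5\<close> any three planes must share a line, because otherwise one of them would lie in
  the sum of the other two; so all planes share one line, and that line is invariant
  (\<open>not_complete\<close>).

  In the empty graph the relations separate into \<open>A\<^sub>i A\<^sub>j = 0\<close> for distant generators and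
  \<open>A\<^sub>i + A\<^sub>i\<^sup>2 + A\<^sub>i A\<^sub>j A\<^sub>i = 0\<close> for adjacent ones. Pushing an eigenvector of \<open>A\<^sub>1\<close> in \<open>I\<^sub>1\<close> along
  \<open>A\<^sub>2, A\<^sub>3, \<dots>\<close> then yields \<open>n - 1\<close> vectors with invariant span, as in the Burau representation,
  against \<open>r \<ge> n\<close> (\<open>not_empty_graph\<close>).
\<close>

section \<open>Rank and eigenvectors\<close>

text \<open>Expanding the rows of \<open>M\<close> in a basis of the row space writes \<open>M\<close> as a sum of as many rank-one
  matrices as the basis has elements. Since \<open>rank\<close> is the dimension of the row space, this is one
  half of the equality of row and column rank over an arbitrary field.\<close>

lemma dim_image_le_dim_rows:
  fixes M :: "'a::field^'n^'m"
  shows "vec.dim (range (\<lambda>x. M *v x)) \<le> vec.dim (rows M)"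
proof -
  obtain B where B: "B \<subseteq> rows M" "vec.independent B" "rows M \<subseteq> vec.span B" "card B = vec.dim (rows M)"
    using vec.basis_exists by blast
  have fin: "finite B" using B(2) by (rule vec.finiteI_independent)
  have "\<exists>c. row i M = (\<Sum>b\<in>B. c b *s b)" for i
  proof -
    have "row i M \<in> vec.span B" using B(3) by (auto simp: rows_def)
    then show ?thesis using vec.span_finite[OF fin] by auto
  qed
  then obtain c where c: "\<And>i. row i M = (\<Sum>b\<in>B. c i b *s b)" by metis
  define C where "C b = (\<chi> i. c i b)" for b
  have "M *v x = (\<Sum>b\<in>B. (\<Sum>j\<in>UNIV. b $ j * x $ j) *s C b)" for x
  proof (rule vec_eq_iff[THEN iffD2], rule allI)
    fix i
    have row: "M $ i $ j = (\<Sum>b\<in>B. c i b * b $ j)" for j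
      using arg_cong[OF c[of i], of "\<lambda>v. v $ j"] by (simp add: row_def)
    have "(M *v x) $ i = (\<Sum>j\<in>UNIV. \<Sum>b\<in>B. c i b * b $ j * x $ j)"
      by (simp add: matrix_vector_mult_def row sum_distrib_right)
    also have "\<dots> = (\<Sum>b\<in>B. \<Sum>j\<in>UNIV. c i b * b $ j * x $ j)"
      by (rule sum.swap)
    also have "\<dots> = (\<Sum>b\<in>B. (\<Sum>j\<in>UNIV. b $ j * x $ j) *s C b) $ i"
      by (simp add: C_def sum_distrib_left sum_distrib_right mult_ac)
    finally show "(M *v x) $ i = (\<Sum>b\<in>B. (\<Sum>j\<in>UNIV. b $ j * x $ j) *s C b) $ i" .
  qed
  then have "range (\<lambda>x. M *v x) \<subseteq> vec.span (C ` B)"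
    by (auto intro!: vec.span_sum vec.span_scale intro: vec.span_base)
  then have "vec.dim (range (\<lambda>x. M *v x)) \<le> card (C ` B)"
    using fin by (intro vec.dim_le_card) auto
  also have "\<dots> \<le> vec.dim (rows M)" using card_image_le[OF fin] B(4) by metis
  finally show ?thesis .
qed

lemma column_in_range: "column i (M :: 'a::field^'n^'m) \<in> range (\<lambda>x. M *v x)"
proof -
  have "M *v axis i 1 = column i M"
    by (simp add: vec_eq_iff column_def matrix_vector_mult_def axis_def if_distrib cong: if_cong)
  then show ?thesis by (metis rangeI)
qed

text \<open>The missing inequality is the previous one for the transpose, as the columns of a matrix
  generate its image.\<close>

lemma dim_range_eq_rank:
  fixes M :: "'a::field^'n^'m"
  shows "vec.dim (range (\<lambda>x. M *v x)) = rank M"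
proof (rule antisym)
  show "vec.dim (range (\<lambda>x. M *v x)) \<le> rank M"
    unfolding row_rank_def_gen by (rule dim_image_le_dim_rows)
  have "rank M = vec.dim (columns (transpose M))"
    by (simp add: row_rank_def_gen)
  also have "\<dots> \<le> vec.dim (range (\<lambda>x. transpose M *v x))"
    using column_in_range[of _ "transpose M"] by (intro vec.dim_subset) (auto simp: columns_def)
  also have "\<dots> \<le> vec.dim (rows (transpose M))" by (rule dim_image_le_dim_rows)
  also have "\<dots> = vec.dim (columns M)" by simp
  also have "\<dots> \<le> vec.dim (range (\<lambda>x. M *v x))"
    using column_in_range[of _ M] by (intro vec.dim_subset) (auto simp: columns_def)
  finally show "rank M \<le> vec.dim (range (\<lambda>x. M *v x))" .
qed

lemma subspace_image_space: "vec.subspace (image_space M)"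
  unfolding image_space_def by (rule vec.subspace_image[OF vec.subspace_UNIV])

lemma dim_two_span_insert:
  assumes "vec.subspace I" "vec.dim I = 2" "x \<in> I" "x \<noteq> 0"
  obtains y where "y \<in> I" "I = vec.span {x, y}"
proof -
  have "vec.independent {x}" using assms(4) by simp
  then obtain B where B: "{x} \<subseteq> B" "B \<subseteq> I" "vec.independent B" "I \<subseteq> vec.span B"
    using vec.maximal_independent_subset_extend[of "{x}" I] assms(3) by auto
  have "card B = 2" using vec.basis_card_eq_dim[OF B(2,4,3)] assms(2) by simp
  then obtain y where y: "B = {x, y}" using B(1) by (auto simp: card_2_iff)
  then have "I = vec.span {x, y}"
    using B vec.span_minimal[OF B(2) assms(1)] by auto
  then show thesis using that y B(2) by auto
qed

lemma dim_two_eq_span: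
  assumes "vec.subspace I" "vec.dim I = 2" "x \<in> I" "y \<in> I" "y \<noteq> 0" "x \<notin> vec.span {y}"
  shows "I = vec.span {x, y}"
proof
  obtain z where z: "I = vec.span {y, z}" using dim_two_span_insert[OF assms(1,2,4,5)] by metis
  have "x \<in> vec.span (insert z {y})" using z assms(3) by (simp add: insert_commute)
  then have "z \<in> vec.span (insert x {y})" by (rule vec.in_span_insert) (use assms in auto)
  then show "I \<subseteq> vec.span {x, y}"
    unfolding z by (intro vec.span_minimal) (auto intro: vec.span_base)
  show "vec.span {x, y} \<subseteq> I" using assms by (intro vec.span_minimal) auto
qed

text \<open>If \<open>x\<close> is not an eigenvector itself, then \<open>x\<close> and \<open>M x\<close> generate the plane, so \<open>x\<close> is annihilated
  by a monic quadratic polynomial in \<open>M\<close>. Over the complex numbers this factors as \<open>(M - l)(M - m)\<close>,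
  and \<open>(M - m) x\<close> is an eigenvector.\<close>

lemma eigenvector_in_plane:
  fixes M :: "complex^'r^'r"
  assumes I: "vec.subspace I" "vec.dim I = 2" and inv: "\<And>x. x \<in> I \<Longrightarrow> M *v x \<in> I"
  obtains y l where "y \<in> I" "y \<noteq> 0" "M *v y = l *s y"
proof -
  obtain x where x: "x \<in> I" "x \<noteq> 0"
  proof -
    have "\<not> I \<subseteq> {0}" using I(2) vec.dim_eq_0[of I] by auto
    then show ?thesis using that by auto
  qed
  show thesis
  proof (cases "M *v x \<in> vec.span {x}")
    case True
    then obtain k where "M *v x = k *s x" by (auto simp: vec.span_singleton)
    then show thesis using that x by blast
  next
    case False
    have "M *v (M *v x) \<in> vec.span {M *v x, x}"
      using dim_two_eq_span[OF I inv[OF x(1)] x False] inv x(1) by blast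
    then obtain a where "M *v (M *v x) - a *s (M *v x) \<in> vec.span {x}"
      using vec.span_breakdown_eq by blast
    then obtain b where "M *v (M *v x) - a *s (M *v x) = b *s x"
      by (auto simp: vec.span_singleton)
    then have ab: "M *v (M *v x) = a *s (M *v x) + b *s x" by (simp add: algebra_simps)
    \<comment> \<open>A root of \<open>l\<^sup>2 = a l + b\<close>; the other root is \<open>a - l\<close>.\<close>
    define l where "l = (a + csqrt (a^2 + 4 * b)) / 2"
    have "2 * l - a = csqrt (a^2 + 4 * b)" by (simp add: l_def field_simps)
    then have "(2 * l - a)^2 = a^2 + 4 * b" by simp
    then have "4 * b = 4 * (l * (l - a))" by (simp add: power2_eq_square algebra_simps)
    then have b: "b = l * (l - a)" by simp
    define y where "y = M *v x - (a - l) *s x"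
    have "y \<noteq> 0"
    proof
      assume "y = 0"
      then have "M *v x = (a - l) *s x" by (simp add: y_def)
      then show False using False by (metis vec.span_base vec.span_scale insertI1)
    qed
    moreover have "y \<in> I" unfolding y_def
      using I(1) inv x(1) by (intro vec.subspace_diff vec.subspace_scale) auto
    moreover have "M *v y = l *s y"
      unfolding y_def vec.diff vec.scale ab b
      by (simp add: vec_eq_iff algebra_simps)
    ultimately show thesis using that by blast
  qed
qed

lemma invertible_conjugation_image_space:
  assumes "invertible (M :: complex^'r^'r)" "M ** P = Q ** M"
  shows "image_space Q = (\<lambda>x. M *v x) ` image_space P"
proof -
  have "surj (\<lambda>x. M *v x)"
    using assms(1) unfolding invertible_def using matrix_right_invertible_surjective by blast
  then have "image_space Q = range (\<lambda>x. Q *v (M *v x))"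
    unfolding image_space_def by (metis image_comp comp_def image_cong)
  also have "\<dots> = range (\<lambda>x. M *v (P *v x))"
    by (simp add: matrix_vector_mul_assoc assms(2))
  finally show ?thesis by (simp add: image_space_def image_image)
qed

lemma commutation_minus_one:
  fixes M P Q :: "'a::field^'n^'n"
  assumes "M ** P = Q ** M"
  shows "M ** (P - mat 1) = (Q - mat 1) ** M"
proof -
  have "M *v (P *v x) = Q *v (M *v x)" for x
    by (simp add: matrix_vector_mul_assoc assms)
  then show ?thesis
    by (simp add: matrix_eq matrix_vector_mult_diff_rdistrib matrix_vector_mult_diff_distrib
        flip: matrix_vector_mul_assoc)
qed

section \<open>Irreducible systems of braid matrices\<close>

text \<open>What the argument uses of a representation: the matrices of the generators, with the braid
  relations, and the absence of common invariant subspaces.\<close>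

locale irreducible_braid_matrices =
  fixes n :: nat and S :: "nat \<Rightarrow> complex^'r^'r"
  assumes invertible_S: "i \<in> {1..<n} \<Longrightarrow> invertible (S i)"
    and braid: "1 \<le> i \<Longrightarrow> i + 1 < n \<Longrightarrow> S i ** S (i + 1) ** S i = S (i + 1) ** S i ** S (i + 1)"
    and commute: "1 \<le> i \<Longrightarrow> i + 2 \<le> j \<Longrightarrow> j < n \<Longrightarrow> S i ** S j = S j ** S i"
    and irreducible: "vec.subspace W \<Longrightarrow> (\<And>i w. i \<in> {1..<n} \<Longrightarrow> w \<in> W \<Longrightarrow> S i *v w \<in> W) \<Longrightarrow>
      W = {0} \<or> W = UNIV"
    and rank_two: "i \<in> {1..<n} \<Longrightarrow> rank (S i - mat 1) = 2"
begin

definition A :: "nat \<Rightarrow> complex^'r^'r" where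
  "A i = S i - mat 1"

definition Img :: "nat \<Rightarrow> (complex^'r) set" where
  "Img i = image_space (A i)"

definition friends :: "nat \<Rightarrow> nat \<Rightarrow> bool" where
  "friends i j \<longleftrightarrow> Img i \<inter> Img j \<noteq> {0}"

lemma friends_sym: "friends i j \<longleftrightarrow> friends j i"
  by (simp add: friends_def Int_commute)

lemma S_vec: "S i *v x = x + A i *v x"
  by (simp add: A_def algebra_simps)

lemma A_in_Img [simp]: "A i *v x \<in> Img i"
  by (simp add: Img_def image_space_def)

lemma subspace_Img: "vec.subspace (Img i)"
  by (simp add: Img_def subspace_image_space)

lemma zero_in_Img [simp]: "0 \<in> Img i"
  using subspace_Img vec.subspace_0 by blast

lemma dim_Img: "i \<in> {1..<n} \<Longrightarrow> vec.dim (Img i) = 2"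
  using rank_two by (simp add: Img_def image_space_def dim_range_eq_rank A_def)

lemma friendsE:
  assumes "friends i j"
  obtains x where "x \<in> Img i" "x \<in> Img j" "x \<noteq> 0"
proof -
  have "\<not> Img i \<inter> Img j \<subseteq> {0}"
    using assms zero_in_Img[of i] zero_in_Img[of j] unfolding friends_def by blast
  then show thesis using that by blast
qed

lemma not_friendsD: "\<not> friends i j \<Longrightarrow> x \<in> Img i \<Longrightarrow> x \<in> Img j \<Longrightarrow> x = 0"
  unfolding friends_def by blast

section \<open>Conjugation of pairs of generators\<close>

text \<open>An invertible matrix that conjugates one pair of generators into another carries the two
  images along.\<close>

lemma friends_conjugate:
  assumes "invertible M" "M ** S i = S i' ** M" "M ** S j = S j' ** M"
  shows "friends i j \<longleftrightarrow> friends i' j'"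
proof -
  have "M ** A k = A k' ** M" if "M ** S k = S k' ** M" for k k'
    using commutation_minus_one[OF that] by (simp add: A_def)
  then have im: "Img i' = (\<lambda>x. M *v x) ` Img i" "Img j' = (\<lambda>x. M *v x) ` Img j"
    using assms invertible_conjugation_image_space unfolding Img_def by blast+
  have inj: "inj (\<lambda>x. M *v x)"
    using assms(1) unfolding invertible_def using matrix_left_invertible_injective by blast
  have "Img i' \<inter> Img j' = (\<lambda>x. M *v x) ` (Img i \<inter> Img j)"
    unfolding im by (rule image_Int[OF inj, symmetric])
  moreover have "(\<lambda>x. M *v x) ` (Img i \<inter> Img j) = {0} \<longleftrightarrow> Img i \<inter> Img j = {0}"
    using inj_image_eq_iff[OF inj, of _ "{0}"] by simp
  ultimately show ?thesis unfolding friends_def by simp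
qed

text \<open>Conjugation by \<open>\<sigma>\<^sub>i \<sigma>\<^sub>i\<^sub>+\<^sub>1 \<sigma>\<^sub>i\<^sub>+\<^sub>2\<close> maps the pair \<open>(\<sigma>\<^sub>i, \<sigma>\<^sub>i\<^sub>+\<^sub>1)\<close> to \<open>(\<sigma>\<^sub>i\<^sub>+\<^sub>1, \<sigma>\<^sub>i\<^sub>+\<^sub>2)\<close>.\<close>

lemma friends_adjacent:
  assumes "1 \<le> i" "i + 1 < n"
  shows "friends i (i + 1) \<longleftrightarrow> friends 1 2"
  using assms
proof (induction i rule: dec_induct)
  case base
  then show ?case by (simp add: numeral_2_eq_2)
next
  case (step i)
  let ?M = "S i ** S (i + 1) ** S (i + 2)"
  have c: "S i ** S (i + 2) = S (i + 2) ** S i" using step by (intro commute) auto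
  have b1: "S i ** S (i + 1) ** S i = S (i + 1) ** S i ** S (i + 1)"
    using step by (intro braid) auto
  have b2: "S (i + 1) ** S (i + 2) ** S (i + 1) = S (i + 2) ** S (i + 1) ** S (i + 2)"
    using braid[of "i + 1"] step by (simp add: numeral_2_eq_2)
  have "friends i (i + 1) \<longleftrightarrow> friends (i + 1) (i + 2)"
  proof (rule friends_conjugate)
    show "invertible ?M" using step by (intro invertible_mult invertible_S) auto
    have "?M ** S i = S i ** S (i + 1) ** (S (i + 2) ** S i)" by (simp only: matrix_mul_assoc)
    also have "\<dots> = S i ** S (i + 1) ** S i ** S (i + 2)"
      by (simp only: c[symmetric] matrix_mul_assoc)
    finally show "?M ** S i = S (i + 1) ** ?M" by (simp only: b1 matrix_mul_assoc)
    have "?M ** S (i + 1) = S i ** (S (i + 1) ** S (i + 2) ** S (i + 1))"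
      by (simp only: matrix_mul_assoc)
    also have "\<dots> = S i ** S (i + 2) ** S (i + 1) ** S (i + 2)"
      by (simp only: b2 matrix_mul_assoc)
    finally show "?M ** S (i + 1) = S (i + 2) ** ?M" by (simp only: c matrix_mul_assoc)
  qed
  then show ?case using step by simp
qed

text \<open>Conjugation by \<open>\<sigma>\<^sub>k \<sigma>\<^sub>k\<^sub>+\<^sub>1\<close> maps \<open>\<sigma>\<^sub>k\<close> to \<open>\<sigma>\<^sub>k\<^sub>+\<^sub>1\<close> and fixes every generator that commutes with both,
  so each index of a distant pair can be moved by one as long as the pair stays distant.\<close>

lemma friends_distant:
  assumes "1 \<le> i" "i + 2 \<le> j" "j < n"
  shows "friends i j \<longleftrightarrow> friends 1 3"
proof -
  have conj: "invertible (S k ** S (k + 1)) \<and>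
      S k ** S (k + 1) ** S k = S (k + 1) ** (S k ** S (k + 1))" if "1 \<le> k" "k + 1 < n" for k
    using that braid[of k] by (auto intro!: invertible_mult invertible_S simp: matrix_mul_assoc)
  have comm: "S k ** S (k + 1) ** S l = S l ** (S k ** S (k + 1))"
    if "S k ** S l = S l ** S k" "S (k + 1) ** S l = S l ** S (k + 1)" for k l
    by (metis that matrix_mul_assoc)
  have "friends 1 j \<longleftrightarrow> friends i j"
    using assms(1,2)
  proof (induction i rule: dec_induct)
    case (step k)
    have "friends k j \<longleftrightarrow> friends (k + 1) j"
      using step assms conj[of k] commute[of k j] commute[of "k + 1" j]
      by (intro friends_conjugate[of "S k ** S (k + 1)"] comm) auto
    then show ?case using step by simp
  qed simp
  moreover have "3 \<le> j" using assms by simp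
  then have "friends 1 3 \<longleftrightarrow> friends 1 j"
    using assms(3)
  proof (induction j rule: dec_induct)
    case (step k)
    have "friends 1 k \<longleftrightarrow> friends 1 (k + 1)"
      using step conj[of k] commute[of 1 k] commute[of 1 "k + 1"]
      by (intro friends_conjugate[of "S k ** S (k + 1)"] comm) auto
    then show ?case using step by simp
  qed simp
  ultimately show ?thesis by simp
qed

lemma friends_iff:
  assumes "i \<in> {1..<n}" "j \<in> {1..<n}" "i \<noteq> j"
  shows "friends i j \<longleftrightarrow> (if j = i + 1 \<or> i = j + 1 then friends 1 2 else friends 1 3)"
proof (cases "i < j")
  case True
  then show ?thesis using assms friends_adjacent[of i] friends_distant[of i j] by auto
next
  case False
  then show ?thesis using assms friends_adjacent[of j] friends_distant[of j i] friends_sym[of i j]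
    by auto
qed

section \<open>Dimension counts\<close>

text \<open>The dimension of a set of vectors is that of its span, so this is the dimension of the sum of
  the planes.\<close>

definition sumdim :: "nat set \<Rightarrow> nat" where
  "sumdim T = vec.dim (\<Union>i\<in>T. Img i)"

lemma sumdim_insert_friend:
  assumes "k \<in> {1..<n}" "j \<in> T" "friends j k"
  shows "sumdim (insert k T) \<le> sumdim T + 1"
proof -
  obtain x where x: "x \<in> Img j" "x \<in> Img k" "x \<noteq> 0" using assms(3) by (rule friendsE)
  obtain y where y: "Img k = vec.span {x, y}"
    using dim_two_span_insert[OF subspace_Img dim_Img[OF assms(1)] x(2,3)] by metis
  let ?U = "\<Union>i\<in>T. Img i"
  have "{x, y} \<subseteq> insert y ?U" using x(1) assms(2) by auto
  then have "Img k \<subseteq> vec.span (insert y ?U)" unfolding y by (rule vec.span_mono)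
  moreover have "?U \<subseteq> vec.span (insert y ?U)" using vec.span_superset by fast
  ultimately have "sumdim (insert k T) \<le> vec.dim (insert y ?U)"
    unfolding sumdim_def by (intro vec.dim_mono) auto
  also have "\<dots> \<le> sumdim T + 1" unfolding sumdim_def by (simp add: vec.dim_insert)
  finally show ?thesis .
qed

lemma sumdim_Un_friends:
  assumes "finite F" "F \<subseteq> {1..<n}" "\<And>k. k \<in> F \<Longrightarrow> \<exists>j\<in>T. friends j k"
  shows "sumdim (T \<union> F) \<le> sumdim T + card F"
  using assms
proof (induction F rule: finite_induct)
  case (insert k F)
  obtain j where "j \<in> T" "friends j k" using insert.prems(2) by blast
  then have "sumdim (insert k (T \<union> F)) \<le> sumdim (T \<union> F) + 1"
    using insert.prems by (intro sumdim_insert_friend) auto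
  then show ?case using insert by simp
qed simp

lemma sumdim_all:
  assumes "n \<ge> 2"
  shows "sumdim {1..<n} = CARD('r)"
proof -
  let ?W = "vec.span (\<Union>i\<in>{1..<n}. Img i)"
  have "?W = {0} \<or> ?W = UNIV"
  proof (rule irreducible)
    fix i w assume iw: "i \<in> {1..<n}" "w \<in> ?W"
    have "A i *v w \<in> ?W" using iw(1) A_in_Img by (intro vec.span_base) blast
    then show "S i *v w \<in> ?W" unfolding S_vec using iw(2) by (rule vec.span_add[rotated])
  qed simp
  moreover have "?W \<noteq> {0}"
  proof
    assume "?W = {0}"
    then have "Img 1 \<subseteq> {0}" using assms vec.span_superset[of "\<Union>i\<in>{1..<n}. Img i"] by fastforce
    then show False using dim_Img[of 1] assms vec.dim_eq_0[of "Img 1"] by auto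
  qed
  ultimately have "?W = UNIV" by blast
  then show ?thesis unfolding sumdim_def by (metis vec.dim_span vec_dim_card)
qed

text \<open>Every plane outside \<open>T\<close> that meets a plane of \<open>T\<close> costs at most one dimension. A set \<open>T\<close> whose
  planes overlap more than a connected graph demands, and which every other plane meets, thus
  contradicts \<open>r \<ge> n\<close>.\<close>

lemma dimension_bound:
  assumes "n \<ge> 2" "T \<subseteq> {1..<n}" "\<And>k. k \<in> {1..<n} - T \<Longrightarrow> \<exists>j\<in>T. friends j k"
  shows "CARD('r) + card T \<le> sumdim T + (n - 1)"
proof -
  have "sumdim (T \<union> ({1..<n} - T)) \<le> sumdim T + card ({1..<n} - T)"
    using assms by (intro sumdim_Un_friends) auto
  moreover have "T \<union> ({1..<n} - T) = {1..<n}" using assms by auto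
  moreover have "card ({1..<n} - T) = n - 1 - card T" 
    using assms(2) by (simp add: card_Diff_subset finite_subset)
  moreover have "card T \<le> n - 1" using card_mono[OF _ assms(2)] by simp
  ultimately show ?thesis using sumdim_all[OF assms(1)] by simp
qed

lemma sumdim_single: "i \<in> {1..<n} \<Longrightarrow> sumdim {i} = 2"
  by (simp add: sumdim_def dim_Img)

text \<open>A plane that meets two others in different lines is the sum of these lines.\<close>

lemma Img_subset_span_two:
  assumes "k \<in> {1..<n}" "x \<in> Img i" "x \<in> Img k" "x \<notin> Img j" "friends j k"
  shows "Img k \<subseteq> vec.span (Img i \<union> Img j)"
proof -
  obtain y where y: "y \<in> Img j" "y \<in> Img k" "y \<noteq> 0" using assms(5) by (rule friendsE)
  have "vec.span {y} \<subseteq> Img j" using y(1) subspace_Img by (intro vec.span_minimal) auto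
  then have "Img k = vec.span {x, y}"
    using assms y by (intro dim_two_eq_span subspace_Img dim_Img) auto
  also have "\<dots> \<subseteq> vec.span (Img i \<union> Img j)" using assms(2) y(1) by (intro vec.span_mono) auto
  finally show ?thesis .
qed

section \<open>The four possible graphs\<close>

text \<open>The planes attach one after the other along the chain.\<close>

lemma chain_dimension:
  assumes "n \<ge> 2" "n \<le> CARD('r)" "friends 1 2"
  shows "CARD('r) = n"
proof -
  have "sumdim {1..k} \<le> k + 1" if "1 \<le> k" "k < n" for k
    using that
  proof (induction k rule: dec_induct)
    case base
    then show ?case by (simp add: sumdim_single)
  next
    case (step k)
    have "sumdim (insert (Suc k) {1..k}) \<le> sumdim {1..k} + 1"
      using step assms(3) friends_adjacent[of k] by (intro sumdim_insert_friend[of _ k]) auto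
    then show ?case using step by (simp add: atLeastAtMostSuc_conv)
  qed
  from this[of "n - 1"] have "sumdim {1..n - 1} \<le> n" using assms(1) by simp
  moreover have "{1..n - 1} = {1..<n}" by auto
  ultimately show ?thesis using sumdim_all assms by simp
qed

text \<open>The dimension count forces the lines in which the planes meet to coincide. A generator \<open>i\<close>
  preserves its own image and that of any distant generator \<open>j\<close>, hence the common line, which is the
  intersection of these two planes. For \<open>n \<ge> 5\<close> every \<open>i\<close> has such a \<open>j\<close>.\<close>

lemma not_complete:
  assumes "n \<ge> 5" "n \<le> CARD('r)" "friends 1 2" "friends 1 3"
  shows False
proof -
  have fr: "friends i j" if "i \<in> {1..<n}" "j \<in> {1..<n}" "i \<noteq> j" for i j
    using friends_iff[OF that] assms by simp
  have third: "Img i \<inter> Img k \<subseteq> Img j"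
    if ijk: "i \<in> {1..<n}" "j \<in> {1..<n}" "k \<in> {1..<n}" "i \<noteq> j" "i \<noteq> k" "j \<noteq> k" for i j k
  proof (rule ccontr)
    assume "\<not> Img i \<inter> Img k \<subseteq> Img j"
    then obtain x where "x \<in> Img i" "x \<in> Img k" "x \<notin> Img j" by blast
    then have "Img k \<subseteq> vec.span (Img i \<union> Img j)"
      using fr ijk by (intro Img_subset_span_two) auto
    then have "sumdim {i, j, k} \<le> sumdim {i, j}"
      unfolding sumdim_def using vec.span_superset[of "Img i \<union> Img j"] by (intro vec.dim_mono) auto
    moreover have "sumdim {j, i} \<le> sumdim {i} + 1"
      using ijk fr by (intro sumdim_insert_friend[of _ i]) auto
    moreover have "CARD('r) + card {i, j, k} \<le> sumdim {i, j, k} + (n - 1)"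
      using assms(1) ijk fr by (intro dimension_bound) auto
    ultimately show False using ijk assms sumdim_single[of i] by (simp add: insert_commute)
  qed
  define L where "L = (\<Inter>k\<in>{1..<n}. Img k)"
  have L: "L = Img i \<inter> Img j" if "i \<in> {1..<n}" "j \<in> {1..<n}" "i \<noteq> j" for i j
  proof
    show "L \<subseteq> Img i \<inter> Img j" using that by (auto simp: L_def)
    show "Img i \<inter> Img j \<subseteq> L" unfolding L_def using third[of i _ j] that by blast
  qed
  have "L = {0} \<or> L = UNIV"
  proof (rule irreducible)
    show "vec.subspace L" unfolding L_def using subspace_Img by (intro vec.subspace_Inter) auto
    fix i w assume iw: "i \<in> {1..<n}" "w \<in> L"
    obtain j where j: "j \<in> {1..<n}" "i + 2 \<le> j \<or> j + 2 \<le> i"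
    proof (cases "i \<le> 2")
      case True then show ?thesis using that[of 4] assms by auto
    next
      case False then show ?thesis using that[of 1] assms by auto
    qed
    have stab: "S i *v w \<in> Img k" if "S i ** S k = S k ** S i" "w \<in> Img k" for k
    proof -
      obtain u where u: "w = A k *v u" using \<open>w \<in> Img k\<close> by (auto simp: Img_def image_space_def)
      have "S i ** A k = A k ** S i"
        using commutation_minus_one[OF that(1)] by (simp add: A_def)
      then have "S i *v w = A k *v (S i *v u)" by (simp add: u matrix_vector_mul_assoc)
      then show ?thesis by simp
    qed
    have "S i ** S j = S j ** S i" using j iw(1) commute[of i j] commute[of j i] by auto
    moreover have Lij: "L = Img i \<inter> Img j" using j iw by (intro L) auto
    ultimately show "S i *v w \<in> L" using iw(2) stab[of i] stab[of j] by auto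
  qed
  moreover have "L = Img 1 \<inter> Img 2" using assms by (intro L) auto
  moreover have "L \<noteq> UNIV"
  proof
    assume "L = UNIV"
    then have "Img 1 = UNIV" using assms(1) by (auto simp: L_def)
    then have "vec.dim (UNIV :: (complex^'r) set) = 2" using dim_Img[of 1] assms(1) by simp
    then show False using assms unfolding vec_dim_card by simp
  qed
  ultimately show False using assms(3) by (auto simp: friends_def)
qed

text \<open>The planes 1 and 2 meet only in 0, and both 4 and 5 meet each of them, hence lie in their sum.
  So four planes fit into dimension 4, while every other plane meets the plane 1.\<close>

lemma not_chain_complement:
  assumes "n \<ge> 6" "n \<le> CARD('r)" "\<not> friends 1 2" "friends 1 3"
  shows False
proof -
  have fr: "friends i j" if "i \<in> {1..<n}" "j \<in> {1..<n}" "i + 2 \<le> j \<or> j + 2 \<le> i" for i j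
    using friends_iff[OF that(1,2)] that(3) assms by auto
  have sub: "Img k \<subseteq> vec.span (Img 1 \<union> Img 2)" if "k = 4 \<or> k = 5" for k
  proof -
    have "friends 1 k" "friends 2 k" using that assms by (auto intro!: fr)
    then obtain x where "x \<in> Img 1" "x \<in> Img k" "x \<noteq> 0" by (auto elim: friendsE)
    then show ?thesis
      using not_friendsD[OF assms(3)] \<open>friends 2 k\<close> that assms
      by (intro Img_subset_span_two[of k x]) auto
  qed
  have "sumdim {1, 2, 4, 5} \<le> vec.dim (Img 1 \<union> Img 2)"
    unfolding sumdim_def using sub vec.span_superset[of "Img 1 \<union> Img 2"] by (intro vec.dim_mono) auto
  also have "\<dots> \<le> 4"
  proof -
    obtain B where B: "B \<subseteq> Img 1" "vec.independent B" "Img 1 \<subseteq> vec.span B" "card B = vec.dim (Img 1)"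
      using vec.basis_exists by blast
    obtain C where C: "C \<subseteq> Img 2" "vec.independent C" "Img 2 \<subseteq> vec.span C" "card C = vec.dim (Img 2)"
      using vec.basis_exists by blast
    have "vec.dim (Img 1 \<union> Img 2) \<le> card (B \<union> C)"
    proof (rule vec.dim_le_card)
      show "Img 1 \<union> Img 2 \<subseteq> vec.span (B \<union> C)"
        using B(3) C(3) vec.span_mono[of B "B \<union> C"] vec.span_mono[of C "B \<union> C"] by blast
      show "finite (B \<union> C)" using B(2) C(2) vec.finiteI_independent by blast
    qed
    also have "\<dots> \<le> card B + card C" by (rule card_Un_le)
    finally show ?thesis using B(4) C(4) assms dim_Img by simp
  qed
  finally have "sumdim {1, 2, 4, 5} \<le> 4" .
  moreover have "CARD('r) + card {1, 2, 4, 5::nat} \<le> sumdim {1, 2, 4, 5} + (n - 1)"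
  proof (rule dimension_bound)
    fix k assume "k \<in> {1..<n} - {1, 2, 4, 5}"
    then have "friends 1 k" using assms by (intro fr) auto
    then show "\<exists>j\<in>{1, 2, 4, 5}. friends j k" by blast
  qed (use assms in auto)
  ultimately show False using assms by simp
qed

text \<open>The edges 1-3, 1-4, 2-4 form a path through all four vertices.\<close>

lemma chain_complement_dimension:
  assumes "n = 5" "n \<le> CARD('r)" "friends 1 3"
  shows "CARD('r) = 5"
proof -
  have fr: "friends i j" if "i \<in> {1..<n}" "j \<in> {1..<n}" "i + 2 \<le> j \<or> j + 2 \<le> i" for i j
    using friends_iff[OF that(1,2)] that(3) assms by auto
  have "sumdim {4, 1} \<le> sumdim {1} + 1"
    using assms(1) by (intro sumdim_insert_friend[of _ 1] fr) auto
  moreover have "CARD('r) + card {4, 1::nat} \<le> sumdim {4, 1} + (n - 1)"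
  proof (rule dimension_bound)
    fix k assume "k \<in> {1..<n} - {4, 1}"
    then have "k = 2 \<or> k = 3" using assms(1) by auto
    then show "\<exists>j\<in>{4, 1}. friends j k" using fr assms(1) by auto
  qed (use assms in auto)
  ultimately show ?thesis using assms sumdim_single[of 1] by simp
qed

text \<open>Let \<open>w\<close> in \<open>I\<^sub>1\<close> satisfy \<open>A\<^sub>1 w = l w\<close> and put \<open>w\<^sub>1 = w\<close>, \<open>w\<^sub>i\<^sub>+\<^sub>1 = A\<^sub>i\<^sub>+\<^sub>1 w\<^sub>i\<close>. The separated relations give
  \<open>A\<^sub>i w\<^sub>i = l w\<^sub>i\<close> and \<open>A\<^sub>i w\<^sub>i\<^sub>+\<^sub>1 = -(1 + l) w\<^sub>i\<close>, and \<open>A\<^sub>j w\<^sub>i = 0\<close> for distant \<open>i\<close>, \<open>j\<close>. So the span of the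
  \<open>n - 1\<close> vectors \<open>w\<^sub>i\<close> is invariant.\<close>

lemma not_empty_graph:
  assumes "n \<ge> 2" "n \<le> CARD('r)" "\<not> friends 1 2" "\<not> friends 1 3"
  shows False
proof -
  have nofr: "\<not> friends i j" if "i \<in> {1..<n}" "j \<in> {1..<n}" "i \<noteq> j" for i j
    using friends_iff[OF that] assms by simp
  have far: "A i *v (A j *v x) = 0"
    if ij: "i \<in> {1..<n}" "j \<in> {1..<n}" "i + 2 \<le> j \<or> j + 2 \<le> i" for i j x
  proof -
    have "S i ** S j = S j ** S i" using ij commute[of i j] commute[of j i] by auto
    then have "S j ** A i = A i ** S j"
      unfolding A_def by (intro commutation_minus_one) simp
    then have "A i ** A j = A j ** A i"
      unfolding A_def[of j] by (intro commutation_minus_one) simp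
    then have "A i *v (A j *v x) = A j *v (A i *v x)" by (simp add: matrix_vector_mul_assoc)
    then have "A i *v (A j *v x) \<in> Img j" by simp
    then show ?thesis using not_friendsD[OF nofr[OF ij(1,2)]] ij(3) by auto
  qed
  have near: "u + A i *v u + A i *v (A (i+1) *v u) = 0" (is ?th1)
    "v + A (i+1) *v v + A (i+1) *v (A i *v v) = 0" (is ?th2)
    if i: "1 \<le> i" "i + 1 < n" and u: "u \<in> Img i" and v: "v \<in> Img (i+1)" for i u v
  proof -
    have eq: "A i *v x + A i *v (A i *v x) + A i *v (A (i+1) *v (A i *v x)) =
       A (i+1) *v x + A (i+1) *v (A (i+1) *v x) + A (i+1) *v (A i *v (A (i+1) *v x))" for x
    proof -
      have "S i *v (S (i+1) *v (S i *v x)) = S (i+1) *v (S i *v (S (i+1) *v x))"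
        using braid[OF i] by (simp add: matrix_vector_mul_assoc matrix_mul_assoc)
      then show ?thesis by (simp add: S_vec vec.add algebra_simps)
    qed
    have in1: "A i *v x + A i *v (A i *v x) + A i *v (A (i+1) *v (A i *v x)) \<in> Img i" for x
      using subspace_Img by (intro vec.subspace_add) auto
    have in2: "A (i+1) *v x + A (i+1) *v (A (i+1) *v x) + A (i+1) *v (A i *v (A (i+1) *v x)) \<in> Img (i+1)" for x
      using subspace_Img by (intro vec.subspace_add) auto
    \<comment> \<open>The two sides of the braid relation lie in planes that meet only in 0.\<close>
    have z: "A i *v x + A i *v (A i *v x) + A i *v (A (i+1) *v (A i *v x)) = 0" for x
      using not_friendsD[OF nofr in1[of x], of "i + 1"] in2[of x] i unfolding eq[of x] by simp
    show ?th1 using u z by (auto simp: Img_def image_space_def)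
    show ?th2 using v z eq by (auto simp: Img_def image_space_def)
  qed
  obtain w l where w: "w \<in> Img 1" "w \<noteq> 0" "A 1 *v w = l *s w"
    using eigenvector_in_plane[OF subspace_Img dim_Img, of 1 "A 1"] assms(1) by auto
  \<comment> \<open>Counting from 0, the vector \<open>v k\<close> lies in the image of the generator with index \<open>k + 1\<close>.\<close>
  define v where "v = rec_nat w (\<lambda>k u. A (k + 2) *v u)"
  have v0: "v 0 = w" and vS: "v (Suc k) = A (k + 2) *v v k" for k
    by (simp_all add: v_def)
  have v_Img: "v k \<in> Img (k + 1)" for k
    using w(1) by (cases k) (simp_all add: v0 vS)
  have down: "A (k + 1) *v v (Suc k) = (- 1 - l) *s v k"
    if "k + 2 < n" "A (k + 1) *v v k = l *s v k" for k
  proof -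
    have "v k + A (k + 1) *v v k + A (k + 1) *v v (Suc k) = 0"
      using near(1)[of "k + 1" "v k" 0] v_Img[of k] that(1) by (simp add: vS)
    then have "A (k + 1) *v v (Suc k) = - (v k + l *s v k)"
      unfolding that(2) add_eq_0_iff .
    then show ?thesis by (simp add: vec_eq_iff algebra_simps)
  qed
  have solve: "b = - a - c" if "a + b + c = 0" for a b c :: "complex^'r"
    using that by (simp add: eq_diff_eq eq_neg_iff_add_eq_0 add_ac)
  have eig: "A (k + 1) *v v k = l *s v k" if "k + 1 < n" for k
    using that
  proof (induction k)
    case 0
    then show ?case using w(3) by (simp add: v0)
  next
    case (Suc k)
    let ?u = "v (Suc k)"
    have "?u + A (k + 2) *v ?u + A (k + 2) *v (A (k + 1) *v ?u) = 0"
      using near(2)[of "k + 1" 0 ?u] v_Img[of "Suc k"] Suc.prems by simp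
    moreover have "A (k + 1) *v ?u = (- 1 - l) *s v k"
      using Suc by (intro down) auto
    then have "A (k + 2) *v (A (k + 1) *v ?u) = (- 1 - l) *s ?u"
      by (simp only: vec.scale vS)
    ultimately have "A (k + 2) *v ?u = - ?u - (- 1 - l) *s ?u"
      using solve by metis
    then show ?case by (simp add: vec_eq_iff algebra_simps)
  qed
  let ?W = "vec.span (v ` {..<n - 1})"
  have base: "v k \<in> ?W" if "k + 1 < n" for k
    using that by (intro vec.span_base) auto
  have "?W = {0} \<or> ?W = UNIV"
  proof (rule irreducible)
    fix i x assume i: "i \<in> {1..<n}" and "x \<in> ?W"
    have "A i *v v k \<in> ?W" if k: "k + 1 < n" for k
    proof -
      consider "i = k + 1" | "i = k + 2" | "i = k" | "i + 2 \<le> k + 1" | "k + 3 \<le> i" by linarith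
      then show ?thesis
      proof cases
        case 1
        then show ?thesis using eig[OF k] base[OF k] by (simp add: vec.span_scale)
      next
        case 2
        then show ?thesis using base[of "Suc k"] i by (simp add: vS)
      next
        case 3
        then obtain m where m: "k = Suc m" using i by (cases k) auto
        then have "A i *v v k = (- 1 - l) *s v m" using down[of m] eig[of m] k 3 by simp
        moreover have "(- 1 - l) *s v m \<in> ?W" using base[of m] k m by (intro vec.span_scale) simp
        ultimately show ?thesis by (simp only:)
      next
        case 4
        obtain y where "v k = A (k + 1) *v y" using v_Img[of k] by (auto simp: Img_def image_space_def)
        then show ?thesis using far[of i "k + 1" y] 4 i k by (simp add: vec.span_zero)
      next
        case 5
        obtain y where "v k = A (k + 1) *v y" using v_Img[of k] by (auto simp: Img_def image_space_def)
        then show ?thesis using far[of i "k + 1" y] 5 i k by (simp add: vec.span_zero)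
      qed
    qed
    then have "(\<lambda>x. A i *v x) ` (v ` {..<n - 1}) \<subseteq> ?W" by auto
    then have "vec.span ((\<lambda>x. A i *v x) ` (v ` {..<n - 1})) \<subseteq> ?W"
      by (intro vec.span_minimal) auto
    then have "A i *v x \<in> ?W" using \<open>x \<in> ?W\<close> by (auto simp: vec.span_image)
    then show "S i *v x \<in> ?W" unfolding S_vec using \<open>x \<in> ?W\<close> by (intro vec.span_add)
  qed simp
  moreover have "w \<in> ?W" using base[of 0] assms(1) by (simp add: v0)
  ultimately have "?W = UNIV" using w(2) by auto
  then have "CARD('r) = vec.dim (v ` {..<n - 1})" by (metis vec.dim_span vec_dim_card)
  also have "\<dots> \<le> card (v ` {..<n - 1})" by (intro vec.dim_le_card vec.span_superset) auto
  also have "\<dots> \<le> n - 1" using card_image_le[of "{..<n - 1}" v] by simp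
  finally show False using assms by simp
qed

end

section \<open>Representations of the braid group\<close>

text \<open>A matrix that is injective and maps a finite-dimensional \<open>W\<close> into itself maps it onto itself, so
  \<open>W\<close> is also invariant under the inverses of the generators; words are handled by induction.\<close>

lemma generator_invariant_imp_invariant:
  fixes \<rho> :: "nat gword set \<Rightarrow> complex^'r^'r"
  assumes hom: "\<rho> \<in> hom (braid_group n) GL" and W: "vec.subspace W"
    and gen: "\<And>i w. i \<in> {1..<n} \<Longrightarrow> w \<in> W \<Longrightarrow> \<rho> (braid_gen n i) *v w \<in> W"
    and g: "g \<in> carrier (braid_group n)" and w: "w \<in> W"
  shows "\<rho> g *v w \<in> W"
proof -
  let ?S = "{1..<n}" and ?E = "word_rel {1..<n} (braid_relations n)" and ?G = "braid_group n"
  have one: "\<rho> \<one>\<^bsub>?G\<^esub> = mat 1"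
    using hom_one[OF hom group_braid_group group_GL] by (simp add: GL_def)
  have one_class: "\<one>\<^bsub>?G\<^esub> = ?E `` {[]}" by (simp add: braid_group_def presented_group_def)
  have carr: "?E `` {u} \<in> carrier ?G" if "u \<in> gwords ?S" for u
    using that by (simp add: braid_group_def presented_group_def quotientI)
  have mult: "\<rho> (?E `` {u @ v}) = \<rho> (?E `` {u}) ** \<rho> (?E `` {v})"
    if "u \<in> gwords ?S" "v \<in> gwords ?S" for u v
    using hom_mult[OF hom carr[OF that(1)] carr[OF that(2)]]
    unfolding braid_group_def presented_group_mult[OF that] by (simp add: GL_def)
  have letter: "\<rho> (?E `` {[(i, b)]}) *v w \<in> W" if i: "i \<in> ?S" and w: "w \<in> W" for i b w
  proof (cases b)
    case True
    then show ?thesis using gen[OF i w] by (simp add: braid_gen_def)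
  next
    case False
    let ?M = "\<rho> (braid_gen n i)" and ?N = "\<rho> (?E `` {[(i, False)]})"
    have "([(i, False), (i, \<not> False)], []) \<in> ?E"
      using word_rel.cancel[of "[]" ?S "[]" i False "braid_relations n"] i by simp
    then have "?E `` {[(i, False), (i, True)]} = ?E `` {[]}"
      using equiv_class_eq[OF equiv_word_rel] by simp
    then have NM: "?N ** ?M = mat 1"
      using mult[of "[(i, False)]" "[(i, True)]"] i one one_class by (simp add: braid_gen_def)
    then have inj: "inj ((*v) ?M)" using matrix_left_invertible_injective by blast
    have "(*v) ?M ` W = W"
    proof (rule vec.subspace_dim_equal)
      show "vec.subspace ((*v) ?M ` W)" using W by (rule vec.subspace_image)
      show "(*v) ?M ` W \<subseteq> W" using gen[OF i] by auto
      show "vec.dim W \<le> vec.dim ((*v) ?M ` W)"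
        using vec.dim_image_eq[OF matrix_vector_mul_linear_gen inj_on_subset[OF inj subset_UNIV]] by simp
    qed (rule W)
    then obtain u where u: "u \<in> W" "w = ?M *v u" using w by blast
    then have "?N *v w = u" by (simp only: matrix_vector_mul_assoc NM matrix_vector_mul_lid)
    then show ?thesis using u False by simp
  qed
  obtain u where u: "u \<in> gwords ?S" "g = ?E `` {u}"
    using g by (auto simp: braid_group_def presented_group_def elim: quotientE)
  have "\<rho> (?E `` {u}) *v w \<in> W"
    using u(1)
  proof (induction u)
    case Nil
    then show ?case using w one by (simp add: one_class)
  next
    case (Cons a u)
    obtain i b where a: "a = (i, b)" by force
    have "\<rho> (?E `` {a # u}) = \<rho> (?E `` {[(i, b)]}) ** \<rho> (?E `` {u})"
      using mult[of "[(i, b)]" u] Cons.prems a by simp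
    then show ?case
      using letter[of i "\<rho> (?E `` {u}) *v w" b] Cons a by (simp add: matrix_vector_mul_assoc)
  qed
  then show ?thesis by (simp add: u(2))
qed

lemma irreducible_rep_braid_matrices:
  fixes \<rho> :: "nat gword set \<Rightarrow> complex^'r^'r"
  assumes irr: "irreducible_rep (braid_group n) \<rho>"
    and rank: "\<forall>i\<in>{1..<n}. rank (gen_part n \<rho> i) = 2"
  shows "irreducible_braid_matrices n (\<lambda>i. \<rho> (braid_gen n i))"
proof
  have hom: "\<rho> \<in> hom (braid_group n) GL" using irr by (simp add: irreducible_rep_def)
  have mult: "\<rho> (x \<otimes>\<^bsub>braid_group n\<^esub> y) = \<rho> x ** \<rho> y"
    if "x \<in> carrier (braid_group n)" "y \<in> carrier (braid_group n)" for x y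
    using hom_mult[OF hom that] by (simp add: GL_def)
  interpret G: group "braid_group n" by (rule group_braid_group)
  fix i j
  show "invertible (\<rho> (braid_gen n i))" if "i \<in> {1..<n}"
    using hom braid_gen_carrier[OF that] by (auto simp: hom_def GL_def)
  show "rank (\<rho> (braid_gen n i) - mat 1) = 2" if "i \<in> {1..<n}"
    using rank that by (simp add: gen_part_def)
  show "\<rho> (braid_gen n i) ** \<rho> (braid_gen n (i + 1)) ** \<rho> (braid_gen n i) =
    \<rho> (braid_gen n (i + 1)) ** \<rho> (braid_gen n i) ** \<rho> (braid_gen n (i + 1))"
    if "1 \<le> i" "i + 1 < n"
    using arg_cong[OF braid_gen_braid[of i n], of \<rho>] that
    by (simp add: mult braid_gen_carrier)
  show "\<rho> (braid_gen n i) ** \<rho> (braid_gen n j) = \<rho> (braid_gen n j) ** \<rho> (braid_gen n i)"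
    if "1 \<le> i" "i + 2 \<le> j" "j < n"
    using arg_cong[OF braid_gen_commute[of i n j], of \<rho>] that
    by (simp add: mult braid_gen_carrier)
  show "W = {0} \<or> W = UNIV" if "vec.subspace W"
    "\<And>i w. i \<in> {1..<n} \<Longrightarrow> w \<in> W \<Longrightarrow> \<rho> (braid_gen n i) *v w \<in> W" for W
    using irr generator_invariant_imp_invariant[OF hom that] that(1)
    unfolding irreducible_rep_def by blast
qed

theorem theorem4p4:
  fixes n :: nat and \<rho> :: "nat gword set \<Rightarrow> complex^'r^'r"
  assumes "irreducible_rep (braid_group n) \<rho>"
    and "CARD('r) \<ge> n"
    and "\<forall>i\<in>{1..<n}. rank (gen_part n \<rho> i) = 2"
  shows "(n \<ge> 6 \<longrightarrow> CARD('r) = n \<and> friendship_graph n \<rho> = chain_graph n) \<and>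
    (n = 5 \<longrightarrow> CARD('r) = 5 \<and>
      (friendship_graph n \<rho> = chain_graph n \<or>
       friendship_graph n \<rho> = ({1, 2, 3, 4}, {{1, 3}, {1, 4}, {2, 4}}))) \<and>
    (n = 4 \<longrightarrow>
      (CARD('r) = 4 \<and> friendship_graph n \<rho> = chain_graph n) \<or>
      friendship_graph n \<rho> = ({1, 2, 3}, {{1, 3}}) \<or>
      friendship_graph n \<rho> = ({1, 2, 3}, {{1, 2}, {2, 3}, {1, 3}}))"
proof -
  interpret irreducible_braid_matrices n "\<lambda>i. \<rho> (braid_gen n i)"
    using assms(1,3) by (rule irreducible_rep_braid_matrices)
  have graph: "friendship_graph n \<rho> = ({1..<n}, {e. \<exists>i\<in>{1..<n}. \<exists>j\<in>{1..<n}. i \<noteq> j \<and>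
      (if j = i + 1 \<or> i = j + 1 then friends 1 2 else friends 1 3) \<and> e = {i, j}})"
  proof -
    have friends: "image_space (gen_part n \<rho> i) \<inter> image_space (gen_part n \<rho> j) \<noteq> {0} \<longleftrightarrow> friends i j"
      for i j
      by (simp add: friends_def Img_def A_def gen_part_def)
    have pair: "i \<noteq> j \<and> friends i j \<and> e = {i, j} \<longleftrightarrow> i \<noteq> j \<and>
        (if j = i + 1 \<or> i = j + 1 then friends 1 2 else friends 1 3) \<and> e = {i, j}"
      if "i \<in> {1..<n}" "j \<in> {1..<n}" for i j e
      using friends_iff[OF that] by blast
    have "(\<exists>i\<in>{1..<n}. \<exists>j\<in>{1..<n}. i \<noteq> j \<and> friends i j \<and> e = {i, j}) \<longleftrightarrow>
      (\<exists>i\<in>{1..<n}. \<exists>j\<in>{1..<n}. i \<noteq> j \<and>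
        (if j = i + 1 \<or> i = j + 1 then friends 1 2 else friends 1 3) \<and> e = {i, j})" for e
      by (rule bex_cong[OF HOL.refl], rule bex_cong[OF HOL.refl], rule pair)
    moreover have "{{i, j} | i j. i \<in> {1..<n} \<and> j \<in> {1..<n} \<and> i \<noteq> j \<and> friends i j} =
      {e. \<exists>i\<in>{1..<n}. \<exists>j\<in>{1..<n}. i \<noteq> j \<and> friends i j \<and> e = {i, j}}"
      by blast
    ultimately show ?thesis
      unfolding friendship_graph_def friends by simp
  qed
  have chain: "CARD('r) = n \<and> friendship_graph n \<rho> = chain_graph n"
    if fr: "n \<ge> 4" "friends 1 2" "\<not> friends 1 3"
  proof
    show "CARD('r) = n" using fr assms(2) by (intro chain_dimension) auto
    have edge: "(\<exists>i\<in>{1..<n}. \<exists>j\<in>{1..<n}. i \<noteq> j \<and>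
        (if j = i + 1 \<or> i = j + 1 then friends 1 2 else friends 1 3) \<and> e = {i, j}) \<longleftrightarrow>
      (\<exists>i. e = {i, i + 1} \<and> i \<in> {1..<n} \<and> i + 1 \<in> {1..<n})" for e
    proof
      assume "\<exists>i\<in>{1..<n}. \<exists>j\<in>{1..<n}. i \<noteq> j \<and>
        (if j = i + 1 \<or> i = j + 1 then friends 1 2 else friends 1 3) \<and> e = {i, j}"
      then obtain i j where ij: "i \<in> {1..<n}" "j \<in> {1..<n}" "e = {i, j}" "j = i + 1 \<or> i = j + 1"
        using fr(3) by (metis (full_types))
      from ij(4) show "\<exists>i. e = {i, i + 1} \<and> i \<in> {1..<n} \<and> i + 1 \<in> {1..<n}"
      proof
        assume "j = i + 1"
        then show ?thesis using ij by (intro exI[of _ i]) simp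
      next
        assume "i = j + 1"
        then show ?thesis using ij by (intro exI[of _ j]) (simp add: insert_commute)
      qed
    next
      assume "\<exists>i. e = {i, i + 1} \<and> i \<in> {1..<n} \<and> i + 1 \<in> {1..<n}"
      then obtain i where "e = {i, i + 1}" "i \<in> {1..<n}" "i + 1 \<in> {1..<n}" by blast
      then show "\<exists>i\<in>{1..<n}. \<exists>j\<in>{1..<n}. i \<noteq> j \<and>
        (if j = i + 1 \<or> i = j + 1 then friends 1 2 else friends 1 3) \<and> e = {i, j}"
        using fr(2) by (intro bexI[of _ i] bexI[of _ "i + 1"]) auto
    qed
    show "friendship_graph n \<rho> = chain_graph n"
      unfolding graph chain_graph_def by (simp only: edge)
  qed
  have vertices4: "{1..<n} = {1, 2, 3}" if "n = 4" using that by auto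
  have vertices5: "{1..<n} = {1, 2, 3, 4}" if "n = 5" using that by auto
  have chain_complement5: "friendship_graph n \<rho> = ({1, 2, 3, 4}, {{1, 3}, {1, 4}, {2, 4}})"
    if "n = 5" "\<not> friends 1 2" "friends 1 3"
    unfolding graph vertices5[OF that(1)] using that(2,3) by (simp add: insert_commute; blast)
  have chain_complement4: "friendship_graph n \<rho> = ({1, 2, 3}, {{1, 3}})"
    if "n = 4" "\<not> friends 1 2" "friends 1 3"
    unfolding graph vertices4[OF that(1)] using that(2,3) by (simp add: insert_commute; blast)
  have complete4: "friendship_graph n \<rho> = ({1, 2, 3}, {{1, 2}, {2, 3}, {1, 3}})"
    if "n = 4" "friends 1 2" "friends 1 3"
    unfolding graph vertices4[OF that(1)] using that(2,3) by (simp add: insert_commute; blast)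
  consider "n < 4"
    | "n \<ge> 4" "friends 1 2" "\<not> friends 1 3"
    | "n \<ge> 4" "friends 1 2" "friends 1 3"
    | "n \<ge> 4" "\<not> friends 1 2" "friends 1 3"
    | "n \<ge> 4" "\<not> friends 1 2" "\<not> friends 1 3"
    by linarith
  then show ?thesis
  proof cases
    case 1
    then show ?thesis by simp
  next
    case 2
    from chain[OF this] show ?thesis by auto
  next
    case 3
    have "\<not> n \<ge> 5" using not_complete[OF _ assms(2) 3(2,3)] by blast
    then have "n = 4" using 3(1) by linarith
    from complete4[OF this 3(2,3)] this show ?thesis by auto
  next
    case 4
    have "\<not> n \<ge> 6" using not_chain_complement[OF _ assms(2) 4(2,3)] by blast
    then have "n = 4 \<or> n = 5" using 4(1) by linarith
    then show ?thesis
    proof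
      assume n: "n = 4"
      from chain_complement4[OF n 4(2,3)] n show ?thesis by auto
    next
      assume n: "n = 5"
      from chain_complement5[OF n 4(2,3)] chain_complement_dimension[OF n assms(2) 4(3)] n
      show ?thesis by auto
    qed
  next
    case 5
    then show ?thesis using not_empty_graph[OF _ assms(2)] by simp
  qed
qed

end
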